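(* Let $U\subseteq\mathcal{P}(\omega)$ be Turing invariant and let $\mathcal{U}=\{[A]:A\in U\}\subseteq\mathcal{S}$. If $\mathcal{U}$ is closed in $(\mathcal{S},\delta)$, then: (1) for every $X\subseteq\omega$ and every $A\in U$ there is $C\in U$ such that $A\le_T C$ and $X\le_T C'$; and (2) every countable Turing ideal contained in $U$ has an upper bound (with respect to $\le_T$) in $U$.
   Context: For $A\subseteq\omega$ and $n\ge1$, $\rho_n(A)=|A\cap[0,n)|/n$, and $\overline{\rho}(A)=\limsup_n\rho_n(A)$. Sets $A,B$ are coarsely similar if $\lim_n \rho_n(A\bigtriangleup B)=0$; $[A]$ is the coarse similarity class of $A$, $\mathcal{S}$ the set of all classes, and $\delta([A],[B])=\overline{\rho}(A\bigtriangleup B)$ is a metric on $\mathcal{S}$. A set $U\subseteq\mathcal{P}(\omega)$ is Turing invariant if it is closed under Turing equivalence. A Turing ideal is a nonempty subset of $\mathcal{P}(\omega)$ closed downward under $\le_T$ and under finite joins. $C'$ is the Turing jump of $C$. *)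

theory Defs
  imports "HOL-Analysis.Analysis" "HOL-Library.Nat_Bijection"
begin

section \<open>Turing reducibility and the Turing jump\<close>

text \<open>
  Kleene's schemes for the partial recursive functions relative to an oracle: constant zero,
  successor, projections, the characteristic function of the oracle, composition, primitive
  recursion, and unbounded minimisation.
\<close>

datatype recf =
    Zero
  | Succ
  | Proj nat
  | Oracle
  | Comp recf "recf list"
  | PrimRec recf recf
  | Mu recf

text \<open>
  \<open>eval C p xs\<close> is the value of program \<open>p\<close> with oracle \<open>C\<close> on the argument list \<open>xs\<close>; \<open>None\<close>
  means divergence. Arity is not tracked in the syntax: a program applied to an argument list of
  unsuitable length diverges. Composition is strict. Recursion and minimisation take place in
  the first argument.
\<close>

fun eval :: "nat set \<Rightarrow> recf \<Rightarrow> nat list \<Rightarrow> nat option" where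
  "eval C Zero xs = Some 0"
| "eval C Succ xs = (case xs of [x] \<Rightarrow> Some (Suc x) | _ \<Rightarrow> None)"
| "eval C (Proj i) xs = (if i < length xs then Some (xs ! i) else None)"
| "eval C Oracle xs = (case xs of [x] \<Rightarrow> Some (if x \<in> C then 1 else 0) | _ \<Rightarrow> None)"
| "eval C (Comp f gs) xs =
     (let ys = map (\<lambda>g. eval C g xs) gs
      in if None \<in> set ys then None else eval C f (map the ys))"
| "eval C (PrimRec f g) xs =
     (case xs of
        [] \<Rightarrow> None
      | n # zs \<Rightarrow> rec_nat (eval C f zs)
                     (\<lambda>k r. case r of None \<Rightarrow> None | Some y \<Rightarrow> eval C g (k # y # zs)) n)"
| "eval C (Mu f) xs =
     (if \<exists>n. eval C f (n # xs) = Some 0 \<and> (\<forall>m<n. eval C f (m # xs) \<noteq> None)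
      then Some (LEAST n. eval C f (n # xs) = Some 0)
      else None)"

definition turing_le :: "nat set \<Rightarrow> nat set \<Rightarrow> bool" (infix "\<le>\<^sub>T" 50) where
  "A \<le>\<^sub>T B \<longleftrightarrow> (\<exists>p. \<forall>x. eval B p [x] = Some (if x \<in> A then 1 else 0))"

definition turing_equiv :: "nat set \<Rightarrow> nat set \<Rightarrow> bool" (infix "\<equiv>\<^sub>T" 50) where
  "A \<equiv>\<^sub>T B \<longleftrightarrow> A \<le>\<^sub>T B \<and> B \<le>\<^sub>T A"

text \<open>An effective injective numbering of the programs, by tagging with the constructor.\<close>

fun code :: "recf \<Rightarrow> nat" where
  "code Zero = prod_encode (0, 0)"
| "code Succ = prod_encode (1, 0)"
| "code (Proj i) = prod_encode (2, i)"
| "code Oracle = prod_encode (3, 0)"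
| "code (Comp f gs) = prod_encode (4, prod_encode (code f, list_encode (map code gs)))"
| "code (PrimRec f g) = prod_encode (5, prod_encode (code f, code g))"
| "code (Mu f) = prod_encode (6, code f)"

lemma code_inject: "code p = code q \<Longrightarrow> p = q"
proof (induction p arbitrary: q)
  case (Comp f gs)
  then obtain f' gs' where q: "q = Comp f' gs'" by (cases q) auto
  with Comp.prems have "code f = code f'" and gs: "map code gs = map code gs'"
    by (auto simp: inj_list_encode[of UNIV, THEN inj_eq])
  then have "f = f'" using Comp.IH(1) by blast
  moreover have "gs = gs'"
    by (rule list.inj_map_strong[OF _ gs]) (use Comp.IH(2) in blast)
  ultimately show ?case by (simp add: q)
next
  case Zero then show ?case by (cases q) auto
next
  case Succ then show ?case by (cases q) auto
next
  case (Proj i) then show ?case by (cases q) auto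
next
  case Oracle then show ?case by (cases q) auto
next
  case (PrimRec f g) then show ?case by (cases q) auto
next
  case (Mu f) then show ?case by (cases q) auto
qed

text \<open>
  The jump \<open>{e. \<Phi>\<^sub>e\<^sup>C(e) halts}\<close>, where \<open>\<Phi>\<^sub>e\<close> is the unary function of the program with code \<open>e\<close>;
  numbers that are not codes index the nowhere defined function.
\<close>

definition jump :: "nat set \<Rightarrow> nat set" where
  "jump C = {e. \<exists>p. code p = e \<and> eval C p [e] \<noteq> None}"

definition turing_invariant :: "nat set set \<Rightarrow> bool" where
  "turing_invariant U \<longleftrightarrow> (\<forall>A\<in>U. \<forall>B. A \<equiv>\<^sub>T B \<longrightarrow> B \<in> U)"

definition turing_join :: "nat set \<Rightarrow> nat set \<Rightarrow> nat set" (infixr "\<oplus>\<^sub>T" 65) where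
  "A \<oplus>\<^sub>T B = {2 * n | n. n \<in> A} \<union> {2 * n + 1 | n. n \<in> B}"

definition turing_ideal :: "nat set set \<Rightarrow> bool" where
  "turing_ideal I \<longleftrightarrow>
     I \<noteq> {} \<and>
     (\<forall>A\<in>I. \<forall>B. B \<le>\<^sub>T A \<longrightarrow> B \<in> I) \<and>
     (\<forall>A\<in>I. \<forall>B\<in>I. A \<oplus>\<^sub>T B \<in> I)"


section \<open>The metric space of coarse similarity classes\<close>

definition density_upto :: "nat \<Rightarrow> nat set \<Rightarrow> real" where
  "density_upto n A = real (card (A \<inter> {..<n})) / real n"

text \<open>The limit superior is taken in the extended reals; it always lies in \<open>[0, 1]\<close>.\<close>

definition upper_density :: "nat set \<Rightarrow> real" where
  "upper_density A = real_of_ereal (limsup (\<lambda>n. ereal (density_upto n A)))"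

definition coarsely_similar :: "nat set \<Rightarrow> nat set \<Rightarrow> bool" where
  "coarsely_similar A B \<longleftrightarrow> (\<lambda>n. density_upto n (sym_diff A B)) \<longlonglongrightarrow> 0"

lemma density_upto_nonneg: "0 \<le> density_upto n A"
  by (simp add: density_upto_def)

lemma density_upto_le_1: "density_upto n A \<le> 1"
proof -
  have "card (A \<inter> {..<n}) \<le> card {..<n}" by (intro card_mono) auto
  then show ?thesis by (cases "n = 0") (auto simp: density_upto_def divide_le_eq_1)
qed

lemma density_upto_subadd:
  assumes "A \<subseteq> B \<union> C"
  shows "density_upto n A \<le> density_upto n B + density_upto n C"
proof -
  have "card (A \<inter> {..<n}) \<le> card (B \<inter> {..<n} \<union> C \<inter> {..<n})"
    by (intro card_mono) (use assms in auto)
  also have "\<dots> \<le> card (B \<inter> {..<n}) + card (C \<inter> {..<n})" by (rule card_Un_le)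
  finally show ?thesis
    by (simp add: density_upto_def divide_right_mono flip: add_divide_distrib of_nat_add)
qed

lemma ereal_upper_density:
  "ereal (upper_density A) = limsup (\<lambda>n. ereal (density_upto n A))"
proof -
  have "0 \<le> limsup (\<lambda>n. ereal (density_upto n A))"
    by (rule le_Limsup) (auto simp: density_upto_nonneg)
  moreover have "limsup (\<lambda>n. ereal (density_upto n A)) \<le> 1"
    by (rule Limsup_bounded) (auto simp: density_upto_le_1)
  ultimately show ?thesis
    unfolding upper_density_def by (intro ereal_real') auto
qed

lemma upper_density_nonneg: "0 \<le> upper_density A"
proof -
  have "0 \<le> limsup (\<lambda>n. ereal (density_upto n A))"
    by (rule le_Limsup) (auto simp: density_upto_nonneg)
  then show ?thesis by (simp add: upper_density_def real_of_ereal_pos)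
qed

lemma upper_density_subadd:
  assumes "A \<subseteq> B \<union> C"
  shows "upper_density A \<le> upper_density B + upper_density C"
proof -
  have "limsup (\<lambda>n. ereal (density_upto n A))
      \<le> limsup (\<lambda>n. ereal (density_upto n B) + ereal (density_upto n C))"
    by (rule Limsup_mono) (simp add: density_upto_subadd[OF assms])
  also have "\<dots> \<le> limsup (\<lambda>n. ereal (density_upto n B)) + limsup (\<lambda>n. ereal (density_upto n C))"
    by (rule ereal_limsup_add_mono)
  finally show ?thesis
    by (simp flip: ereal_upper_density)
qed

lemma upper_density_eq_0_iff: "upper_density A = 0 \<longleftrightarrow> (\<lambda>n. density_upto n A) \<longlonglongrightarrow> 0"
proof
  assume "upper_density A = 0"
  then have *: "limsup (\<lambda>n. ereal (density_upto n A)) = 0"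
    by (simp flip: ereal_upper_density)
  have "0 \<le> liminf (\<lambda>n. ereal (density_upto n A))"
    by (rule Liminf_bounded) (auto simp: density_upto_nonneg)
  moreover have "liminf (\<lambda>n. ereal (density_upto n A)) \<le> limsup (\<lambda>n. ereal (density_upto n A))"
    by (rule Liminf_le_Limsup) simp
  ultimately have "(\<lambda>n. ereal (density_upto n A)) \<longlonglongrightarrow> 0"
    using * by (intro Liminf_eq_Limsup) auto
  then show "(\<lambda>n. density_upto n A) \<longlonglongrightarrow> 0"
    by (simp add: zero_ereal_def)
next
  assume "(\<lambda>n. density_upto n A) \<longlonglongrightarrow> 0"
  then have "(\<lambda>n. ereal (density_upto n A)) \<longlonglongrightarrow> ereal 0" by simp
  then have "limsup (\<lambda>n. ereal (density_upto n A)) = ereal 0"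
    by (intro lim_imp_Limsup) auto
  then show "upper_density A = 0" by (simp add: upper_density_def)
qed

lemma upper_density_sym_diff_triangle:
  "upper_density (sym_diff A C) \<le> upper_density (sym_diff A B) + upper_density (sym_diff B C)"
  by (rule upper_density_subadd) auto

lemma coarsely_similar_iff: "coarsely_similar A B \<longleftrightarrow> upper_density (sym_diff A B) = 0"
  by (simp add: coarsely_similar_def upper_density_eq_0_iff)

quotient_type coarse_class = "nat set" / coarsely_similar
  morphisms rep_coarse_class coarse_class
proof (rule equivpI)
  show "reflp coarsely_similar"
    by (auto intro!: reflpI simp: coarsely_similar_def density_upto_def)
  show "symp coarsely_similar"
    by (auto intro!: sympI simp: coarsely_similar_def Un_commute)
  show "transp coarsely_similar"
  proof (rule transpI)
    fix A B C
    assume "coarsely_similar A B" "coarsely_similar B C"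
    then show "coarsely_similar A C"
      using upper_density_sym_diff_triangle[of A C B] upper_density_nonneg[of "sym_diff A C"]
      by (simp add: coarsely_similar_iff)
  qed
qed

instantiation coarse_class :: metric_space
begin

lift_definition dist_coarse_class :: "coarse_class \<Rightarrow> coarse_class \<Rightarrow> real"
  is "\<lambda>A B. upper_density (sym_diff A B)"
proof -
  fix A A' B B'
  assume "coarsely_similar A A'" "coarsely_similar B B'"
  then have "upper_density (sym_diff A A') = 0" "upper_density (sym_diff A' A) = 0"
    "upper_density (sym_diff B B') = 0" "upper_density (sym_diff B' B) = 0"
    by (simp_all add: coarsely_similar_iff Un_commute)
  then show "upper_density (sym_diff A B) = upper_density (sym_diff A' B')"
    using upper_density_sym_diff_triangle[of A B A'] upper_density_sym_diff_triangle[of A' B B']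
      upper_density_sym_diff_triangle[of A' B' A] upper_density_sym_diff_triangle[of A B' B]
    by linarith
qed

definition uniformity_coarse_class :: "(coarse_class \<times> coarse_class) filter" where
  "uniformity_coarse_class = (INF e\<in>{0 <..}. principal {(x, y). dist x y < e})"

definition open_coarse_class :: "coarse_class set \<Rightarrow> bool" where
  "open_coarse_class S \<longleftrightarrow> (\<forall>x\<in>S. \<forall>\<^sub>F (x', y) in uniformity. x' = x \<longrightarrow> y \<in> S)"

instance
proof
  fix x y z :: coarse_class
  show "dist x y = 0 \<longleftrightarrow> x = y"
    by transfer (simp add: coarsely_similar_iff)
  show "dist x y \<le> dist x z + dist y z"
    by transfer (metis Un_commute upper_density_sym_diff_triangle)
qed (simp_all only: uniformity_coarse_class_def open_coarse_class_def)

end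

end

theory Submission
  imports Defs
begin

text \<open>
  Given sets \<open>h 0, h 1, \<dots>\<close>, code the bit \<open>s \<in> h k\<close> by filling or leaving empty the interval
  \<open>block k s\<close>, which occupies a fraction \<open>1 / 2 ^ (k + 2)\<close> of the numbers below its dyadic upper bound. The
  code of \<open>h 0, \<dots>, h K\<close> tends to the code \<open>D\<close> of the whole sequence as \<open>K\<close> grows, so if all these
  finite codes lie in \<open>U\<close>, closedness yields some \<open>B \<in> U\<close> coarsely similar to \<open>D\<close>. A majority vote
  of \<open>B\<close> on \<open>block k s\<close> is correct for all but finitely many \<open>s\<close>, hence every \<open>h k\<close> is computable
  from \<open>B\<close>. For (2), let \<open>h\<close> enumerate the ideal. For (1), let \<open>h 0 = A\<close> and let \<open>h (k + 1)\<close> be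
  everything or nothing according to whether \<open>k \<in> X\<close>: the finite codes are Turing equivalent
  to \<open>A\<close>, and \<open>X\<close> is a limit of votes computable from \<open>B\<close>, hence computable from the jump of \<open>B\<close>.
\<close>

section \<open>Relative computability\<close>

text \<open>\<open>eval\<close> does not track arity, so only lists of length \<open>n\<close> are
  constrained. Partial programs enter only through \<open>Mu\<close> and the jump; the closure rules
  below concern total functions.\<close>

definition computable :: "nat set \<Rightarrow> nat \<Rightarrow> (nat list \<Rightarrow> nat) \<Rightarrow> bool" where
  "computable C n F \<longleftrightarrow> (\<exists>p. \<forall>xs. length xs = n \<longrightarrow> eval C p xs = Some (F xs))"

definition decidable :: "nat set \<Rightarrow> nat \<Rightarrow> (nat list \<Rightarrow> bool) \<Rightarrow> bool" where
  "decidable C n P \<longleftrightarrow> computable C n (\<lambda>xs. of_bool (P xs))"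

lemma computable_cong:
  assumes "\<And>xs. length xs = n \<Longrightarrow> F xs = G xs"
  shows "computable C n F \<longleftrightarrow> computable C n G"
  unfolding computable_def using assms by metis

lemma turing_le_iff: "A \<le>\<^sub>T B \<longleftrightarrow> decidable B 1 (\<lambda>xs. xs ! 0 \<in> A)"
proof -
  have "(\<forall>x. eval B p [x] = Some (if x \<in> A then 1 else 0)) \<longleftrightarrow>
      (\<forall>xs. length xs = 1 \<longrightarrow> eval B p xs = Some (of_bool (xs ! 0 \<in> A)))" for p
    by (auto simp: length_Suc_conv of_bool_def)
  then show ?thesis by (simp add: turing_le_def decidable_def computable_def)
qed

lemma computable_nth: "i < n \<Longrightarrow> computable C n (\<lambda>xs. xs ! i)"
  unfolding computable_def by (rule exI[of _ "Proj i"]) simp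

lemma eval_Comp_total:
  assumes "\<And>i. i < length gs \<Longrightarrow> eval C (gs ! i) xs = Some (ys ! i)" "length ys = length gs"
  shows "eval C (Comp f gs) xs = eval C f ys"
proof -
  have "map (\<lambda>g. eval C g xs) gs = map Some ys"
    by (rule nth_equalityI) (use assms in auto)
  then show ?thesis by (auto simp: Let_def comp_def)
qed

lemma computable_comp:
  assumes "computable C (length Gs) F" "\<And>G. G \<in> set Gs \<Longrightarrow> computable C n G"
  shows "computable C n (\<lambda>xs. F (map (\<lambda>G. G xs) Gs))"
proof -
  obtain f where f: "\<And>xs. length xs = length Gs \<Longrightarrow> eval C f xs = Some (F xs)"
    using assms(1) unfolding computable_def by blast
  obtain g where g: "\<And>G xs. G \<in> set Gs \<Longrightarrow> length xs = n \<Longrightarrow> eval C (g G) xs = Some (G xs)"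
    using assms(2) unfolding computable_def by metis
  have "eval C (Comp f (map g Gs)) xs = Some (F (map (\<lambda>G. G xs) Gs))" if "length xs = n" for xs
    using that by (subst eval_Comp_total[where ys = "map (\<lambda>G. G xs) Gs"]) (auto simp: f g)
  then show ?thesis unfolding computable_def by blast
qed

lemma computable_comp1:
  assumes "computable C 1 (\<lambda>xs. f (xs ! 0))" "computable C n G"
  shows "computable C n (\<lambda>xs. f (G xs))"
  using computable_comp[of C "[G]" "\<lambda>xs. f (xs ! 0)" n] assms by simp

lemma computable_comp2:
  assumes "computable C 2 (\<lambda>xs. f (xs ! 0) (xs ! 1))" "computable C n G" "computable C n H"
  shows "computable C n (\<lambda>xs. f (G xs) (H xs))"
  using computable_comp[of C "[G, H]" "\<lambda>xs. f (xs ! 0) (xs ! 1)" n] assms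
  by (auto simp: numeral_2_eq_2)

lemma computable_drop:
  assumes "computable C n F"
  shows "computable C (m + n) (\<lambda>xs. F (drop m xs))"
proof -
  have "computable C (m + n) (\<lambda>xs. F (map (\<lambda>G. G xs) (map (\<lambda>i xs. xs ! (m + i)) [0..<n])))"
    by (rule computable_comp) (use assms in \<open>auto intro: computable_nth\<close>)
  also have "?this \<longleftrightarrow> ?thesis"
  proof (rule computable_cong)
    fix xs :: "nat list" assume "length xs = m + n"
    then have "map (\<lambda>G. G xs) (map (\<lambda>i xs. xs ! (m + i)) [0..<n]) = drop m xs"
      by (intro nth_equalityI) auto
    then show "F (map (\<lambda>G. G xs) (map (\<lambda>i xs. xs ! (m + i)) [0..<n])) = F (drop m xs)"
      by (rule arg_cong)
  qed
  finally show ?thesis .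
qed

lemma computable_Suc: "computable C n F \<Longrightarrow> computable C n (\<lambda>xs. Suc (F xs))"
proof (rule computable_comp1[of C Suc])
  show "computable C 1 (\<lambda>xs. Suc (xs ! 0))"
    unfolding computable_def by (rule exI[of _ Succ]) (auto simp: length_Suc_conv)
qed

fun numeral_prog :: "nat \<Rightarrow> recf" where
  "numeral_prog 0 = Zero"
| "numeral_prog (Suc m) = Comp Succ [numeral_prog m]"

lemma eval_numeral_prog: "eval C (numeral_prog m) xs = Some m"
  by (induction m) (simp_all add: Let_def)

lemma computable_const: "computable C n (\<lambda>_. m)"
  unfolding computable_def using eval_numeral_prog by blast

lemma computable_oracle: "computable C 1 (\<lambda>xs. of_bool (xs ! 0 \<in> C))"
  unfolding computable_def by (rule exI[of _ Oracle]) (auto simp: length_Suc_conv)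

text \<open>Counter and accumulator precede the parameters because \<open>PrimRec\<close> recurses
  on its first argument. Composing with \<open>G\<close> and projections then puts a computed bound
  in that argument.\<close>

lemma computable_rec_nat:
  assumes F: "computable C n F" and G: "computable C n G"
    and H: "computable C (Suc (Suc n)) (\<lambda>ys. H (ys ! 0) (ys ! 1) (drop 2 ys))"
  shows "computable C n (\<lambda>xs. rec_nat (F xs) (\<lambda>k r. H k r xs) (G xs))"
proof -
  obtain f where f: "\<And>xs. length xs = n \<Longrightarrow> eval C f xs = Some (F xs)"
    using F unfolding computable_def by blast
  obtain h where h: "\<And>ys. length ys = Suc (Suc n) \<Longrightarrow>
      eval C h ys = Some (H (ys ! 0) (ys ! 1) (drop 2 ys))"
    using H unfolding computable_def by blast
  have "eval C (PrimRec f h) (k # xs) = Some (rec_nat (F xs) (\<lambda>k r. H k r xs) k)"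
    if "length xs = n" for k xs
    using that by (induction k) (simp_all add: f h)
  then have "computable C (Suc n) (\<lambda>ys. rec_nat (F (drop 1 ys)) (\<lambda>k r. H k r (drop 1 ys)) (ys ! 0))"
    unfolding computable_def
    by (intro exI[of _ "PrimRec f h"]) (auto simp: length_Suc_conv simp del: eval.simps)
  then have "computable C n (\<lambda>xs. (\<lambda>ys. rec_nat (F (drop 1 ys)) (\<lambda>k r. H k r (drop 1 ys)) (ys ! 0))
      (map (\<lambda>G. G xs) (G # map (\<lambda>i xs. xs ! i) [0..<n])))"
    by (intro computable_comp) (auto intro: G computable_nth)
  also have "?this \<longleftrightarrow> ?thesis"
  proof (rule computable_cong)
    fix xs :: "nat list" assume "length xs = n"
    then have "map (\<lambda>G. G xs) (map (\<lambda>i xs. xs ! i) [0..<n]) = xs"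
      by (intro nth_equalityI) auto
    then show "rec_nat (F (drop 1 (map (\<lambda>G. G xs) (G # map (\<lambda>i xs. xs ! i) [0..<n]))))
        (\<lambda>k r. H k r (drop 1 (map (\<lambda>G. G xs) (G # map (\<lambda>i xs. xs ! i) [0..<n]))))
        (map (\<lambda>G. G xs) (G # map (\<lambda>i xs. xs ! i) [0..<n]) ! 0) =
        rec_nat (F xs) (\<lambda>k r. H k r xs) (G xs)" by simp
  qed
  finally show ?thesis .
qed

section \<open>Arithmetic and bounded sums\<close>

lemma computable_add:
  assumes "computable C n F" "computable C n G"
  shows "computable C n (\<lambda>xs. F xs + G xs)"
proof -
  have "rec_nat a (\<lambda>_. Suc) b = a + b" for a b :: nat by (induction b) auto
  moreover have "computable C n (\<lambda>xs. rec_nat (F xs) (\<lambda>_ r. Suc r) (G xs))"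
    by (intro computable_rec_nat assms computable_Suc computable_nth) simp
  ultimately show ?thesis by simp
qed

lemma computable_mult:
  assumes "computable C n F" "computable C n G"
  shows "computable C n (\<lambda>xs. F xs * G xs)"
proof -
  have "rec_nat 0 (\<lambda>_ r. r + a) b = a * b" for a b :: nat by (induction b) auto
  moreover have "computable C n (\<lambda>xs. rec_nat 0 (\<lambda>_ r. r + F xs) (G xs))"
    using computable_drop[of C n F 2] assms
    by (intro computable_rec_nat computable_const computable_add computable_nth) auto
  ultimately show ?thesis by simp
qed

lemma computable_power2:
  assumes "computable C n F"
  shows "computable C n (\<lambda>xs. 2 ^ F xs)"
proof -
  have "rec_nat 1 (\<lambda>_ r. 2 * r) b = (2::nat) ^ b" for b by (induction b) auto
  moreover have "computable C n (\<lambda>xs. rec_nat 1 (\<lambda>_ r. 2 * r) (F xs))"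
    by (intro computable_rec_nat computable_const computable_mult assms computable_nth) simp
  ultimately show ?thesis by simp
qed

lemma computable_diff:
  assumes "computable C n F" "computable C n G"
  shows "computable C n (\<lambda>xs. F xs - G xs)"
proof -
  \<comment> \<open>Returning the counter and discarding the accumulator gives the predecessor;
    iterating it gives truncated subtraction.\<close>
  have "rec_nat 0 (\<lambda>k _. k) b = b - 1" for b :: nat by (cases b) auto
  moreover have "computable C m (\<lambda>xs. rec_nat 0 (\<lambda>k _. k) (H xs))" if "computable C m H" for m H
    using that by (intro computable_rec_nat computable_const computable_nth) simp_all
  ultimately have pred: "computable C m (\<lambda>xs. H xs - 1)" if "computable C m H" for m H
    using that by simp
  have "rec_nat a (\<lambda>_ r. r - 1) b = a - b" for a b :: nat by (induction b) auto
  moreover have "computable C n (\<lambda>xs. rec_nat (F xs) (\<lambda>_ r. r - 1) (G xs))"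
    by (intro computable_rec_nat assms pred computable_nth) simp
  ultimately show ?thesis by simp
qed

lemma computable_sum:
  assumes F: "computable C (Suc n) (\<lambda>ys. F (ys ! 0) (tl ys))" and G: "computable C n G"
  shows "computable C n (\<lambda>xs. \<Sum>i<G xs. F i xs)"
proof -
  have "rec_nat 0 (\<lambda>k r. r + f k) b = (\<Sum>i<b. f i)" for b and f :: "nat \<Rightarrow> nat"
    by (induction b) auto
  moreover have "computable C n (\<lambda>xs. rec_nat 0 (\<lambda>k r. r + F k xs) (G xs))"
  proof (intro computable_rec_nat computable_const computable_add computable_nth G)
    \<comment> \<open>The projections keep the counter and the parameters and skip the accumulator
      at position 1.\<close>
    have "computable C (Suc (Suc n)) (\<lambda>ys. (\<lambda>ys. F (ys ! 0) (tl ys))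
        (map (\<lambda>G. G ys) ((\<lambda>ys. ys ! 0) # map (\<lambda>i ys. ys ! (2 + i)) [0..<n])))"
      by (intro computable_comp) (auto intro: computable_nth F)
    also have "?this \<longleftrightarrow> computable C (Suc (Suc n)) (\<lambda>ys. F (ys ! 0) (drop 2 ys))"
    proof (rule computable_cong)
      fix ys :: "nat list" assume "length ys = Suc (Suc n)"
      then have "map (\<lambda>G. G ys) (map (\<lambda>i ys. ys ! (2 + i)) [0..<n]) = drop 2 ys"
        by (intro nth_equalityI) auto
      then show "F (map (\<lambda>G. G ys) ((\<lambda>ys. ys ! 0) # map (\<lambda>i ys. ys ! (2 + i)) [0..<n]) ! 0)
          (tl (map (\<lambda>G. G ys) ((\<lambda>ys. ys ! 0) # map (\<lambda>i ys. ys ! (2 + i)) [0..<n]))) =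
          F (ys ! 0) (drop 2 ys)" by simp
    qed
    finally show "computable C (Suc (Suc n)) (\<lambda>ys. F (ys ! 0) (drop 2 ys))" .
  qed simp
  ultimately show ?thesis by simp
qed

lemma computable_tl_nth: "i < n \<Longrightarrow> computable C (Suc n) (\<lambda>ys. tl ys ! i)"
  using computable_drop[OF computable_nth, of i n C 1] by (simp add: drop_Suc)

lemma computable_prod_encode:
  assumes "computable C n F" "computable C n G"
  shows "computable C n (\<lambda>xs. prod_encode (F xs, G xs))"
proof -
  have "triangle b = (\<Sum>i<b. Suc i)" for b by (induction b) auto
  then have "prod_encode (a, b) = (\<Sum>i<a + b. Suc i) + a" for a b
    by (simp add: prod_encode_def)
  moreover have "computable C n (\<lambda>xs. (\<Sum>i<F xs + G xs. Suc i) + F xs)"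
    by (intro computable_sum computable_add computable_Suc computable_nth assms) simp
  ultimately show ?thesis by simp
qed

section \<open>Decidable relations and minimisation\<close>

lemma decidable_mem:
  assumes "A \<le>\<^sub>T C" "computable C n F"
  shows "decidable C n (\<lambda>xs. F xs \<in> A)"
  using assms unfolding turing_le_iff decidable_def by (rule computable_comp1)

lemma decidable_not:
  assumes "decidable C n P"
  shows "decidable C n (\<lambda>xs. \<not> P xs)"
proof -
  have "computable C n (\<lambda>xs. 1 - of_bool (P xs))"
    by (intro computable_diff computable_const assms[unfolded decidable_def])
  moreover have "1 - of_bool b = (of_bool (\<not> b) :: nat)" for b by simp
  ultimately show ?thesis by (simp only: decidable_def)
qed

lemma decidable_conj:
  assumes "decidable C n P" "decidable C n Q"
  shows "decidable C n (\<lambda>xs. P xs \<and> Q xs)"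
  using computable_mult[OF assms[unfolded decidable_def]] by (simp add: decidable_def of_bool_conj)

lemma decidable_disj:
  assumes "decidable C n P" "decidable C n Q"
  shows "decidable C n (\<lambda>xs. P xs \<or> Q xs)"
  using decidable_not[OF decidable_conj[OF assms[THEN decidable_not]]] by simp

lemma decidable_le:
  assumes "computable C n F" "computable C n G"
  shows "decidable C n (\<lambda>xs. F xs \<le> G xs)"
proof -
  have "computable C n (\<lambda>xs. 1 - (F xs - G xs))"
    by (intro computable_diff computable_const assms)
  moreover have "1 - (a - b) = of_bool (a \<le> b)" for a b :: nat by auto
  ultimately show ?thesis by (simp add: decidable_def)
qed

lemma decidable_eq:
  assumes "computable C n F" "computable C n G"
  shows "decidable C n (\<lambda>xs. F xs = G xs)"
  using decidable_conj[OF decidable_le decidable_le, OF assms assms(2,1)] by (simp add: eq_iff)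

lemma decidable_less:
  assumes "computable C n F" "computable C n G"
  shows "decidable C n (\<lambda>xs. F xs < G xs)"
  using decidable_le[OF computable_Suc] assms by (simp add: Suc_le_eq)

lemma decidable_bex:
  assumes "decidable C (Suc n) (\<lambda>ys. P (ys ! 0) (tl ys))" "computable C n G"
  shows "decidable C n (\<lambda>xs. \<exists>i<G xs. P i xs)"
proof -
  have "decidable C n (\<lambda>xs. 0 < (\<Sum>i<G xs. of_bool (P i xs) :: nat))"
    by (intro decidable_less computable_const computable_sum assms assms(1)[unfolded decidable_def])
  moreover have "0 < (\<Sum>i<b. of_bool (Q i) :: nat) \<longleftrightarrow> (\<exists>i<b. Q i)" for Q and b :: nat
    by (subst neq0_conv[symmetric], subst sum_eq_0_iff) auto
  ultimately show ?thesis by (simp only:)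
qed

lemma computable_Least:
  assumes P: "decidable C (Suc n) (\<lambda>ys. P (ys ! 0) (tl ys))"
    and ex: "\<And>xs. length xs = n \<Longrightarrow> \<exists>y. P y xs"
  shows "computable C n (\<lambda>xs. LEAST y. P y xs)"
proof -
  \<comment> \<open>\<open>Mu\<close> searches for a zero, so the program has to decide the
    negation: value 0 means that \<open>P\<close> holds.\<close>
  obtain p where p: "\<And>ys. length ys = Suc n \<Longrightarrow> eval C p ys = Some (of_bool (\<not> P (ys ! 0) (tl ys)))"
    using decidable_not[OF P] unfolding decidable_def computable_def by blast
  have "eval C (Mu p) xs = Some (LEAST y. P y xs)" if "length xs = n" for xs
    using that ex[OF that] by (simp add: p)
  then show ?thesis unfolding computable_def by blast
qed


section \<open>Turing reducibility\<close>

text \<open>In the oracle clause the value of \<open>Succ\<close> is discarded, but it makes the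
  call diverge, as \<open>Oracle\<close> does, on lists of length other than one, where
  \<open>p\<close> alone might converge.\<close>

fun oracle_subst :: "recf \<Rightarrow> recf \<Rightarrow> recf" where
  "oracle_subst p Zero = Zero"
| "oracle_subst p Succ = Succ"
| "oracle_subst p (Proj i) = Proj i"
| "oracle_subst p Oracle = Comp (Proj 0) [p, Succ]"
| "oracle_subst p (Comp f gs) = Comp (oracle_subst p f) (map (oracle_subst p) gs)"
| "oracle_subst p (PrimRec f g) = PrimRec (oracle_subst p f) (oracle_subst p g)"
| "oracle_subst p (Mu f) = Mu (oracle_subst p f)"

lemma eval_oracle_subst:
  assumes p: "\<And>x. eval C p [x] = Some (if x \<in> B then 1 else 0)"
  shows "eval C (oracle_subst p q) xs = eval B q xs"
proof (induction q arbitrary: xs)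
  case Oracle
  show ?case by (auto simp: Let_def p split: list.splits)
next
  case (Comp f gs)
  have "map (\<lambda>g. eval C g xs) (map (oracle_subst p) gs) = map (\<lambda>g. eval B g xs) gs"
    using Comp.IH(2) by simp
  then show ?case by (simp add: Comp.IH(1) Let_def cong: map_cong)
next
  case (PrimRec f g)
  then show ?case by (simp cong: list.case_cong)
qed auto

lemma turing_le_trans:
  assumes "A \<le>\<^sub>T B" "B \<le>\<^sub>T C"
  shows "A \<le>\<^sub>T C"
  using assms eval_oracle_subst unfolding turing_le_def by metis

lemma turing_le_refl: "A \<le>\<^sub>T A"
  using computable_oracle by (simp add: turing_le_iff decidable_def)

lemma turing_le_join1: "A \<le>\<^sub>T A \<oplus>\<^sub>T B"
proof -
  have "decidable (A \<oplus>\<^sub>T B) 1 (\<lambda>xs. 2 * xs ! 0 \<in> A \<oplus>\<^sub>T B)"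
    by (intro decidable_mem turing_le_refl computable_mult computable_const computable_nth) simp
  moreover have "2 * x \<in> A \<oplus>\<^sub>T B \<longleftrightarrow> x \<in> A" for x
    unfolding turing_join_def by (auto, presburger)
  ultimately show ?thesis by (simp add: turing_le_iff)
qed

lemma turing_le_join2: "B \<le>\<^sub>T A \<oplus>\<^sub>T B"
proof -
  have "decidable (A \<oplus>\<^sub>T B) 1 (\<lambda>xs. 2 * xs ! 0 + 1 \<in> A \<oplus>\<^sub>T B)"
    by (intro decidable_mem turing_le_refl computable_add computable_mult computable_const
        computable_nth) simp
  moreover have "2 * x + 1 \<in> A \<oplus>\<^sub>T B \<longleftrightarrow> x \<in> B" for x
    unfolding turing_join_def by (auto, presburger)
  ultimately show ?thesis by (simp add: turing_le_iff)
qed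

lemma turing_le_Un: "A \<le>\<^sub>T C \<Longrightarrow> B \<le>\<^sub>T C \<Longrightarrow> A \<union> B \<le>\<^sub>T C"
  unfolding turing_le_iff by (simp add: decidable_disj)

lemma finite_turing_le: "finite F \<Longrightarrow> F \<le>\<^sub>T C"
proof (induction rule: finite_induct)
  case empty
  show ?case unfolding turing_le_iff decidable_def by (simp add: computable_const)
next
  case (insert x F)
  then show ?case unfolding turing_le_iff insert_iff
    by (intro decidable_disj decidable_eq computable_const computable_nth) simp_all
qed

lemma UNIV_turing_le: "UNIV \<le>\<^sub>T C"
  unfolding turing_le_iff decidable_def by (simp add: computable_const)

lemma turing_le_UN_atMost:
  fixes K :: nat
  shows "(\<And>k. k \<le> K \<Longrightarrow> A k \<le>\<^sub>T C) \<Longrightarrow> (\<Union>k\<le>K. A k) \<le>\<^sub>T C"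
  by (induction K) (auto simp: atMost_Suc intro: turing_le_Un)

text \<open>The exceptions below \<open>s0\<close> form a finite set, which can be hard-wired into a
  program.\<close>

lemma turing_le_eventually:
  assumes "B \<le>\<^sub>T C" "\<And>s. s \<ge> s0 \<Longrightarrow> s \<in> A \<longleftrightarrow> s \<in> B"
  shows "A \<le>\<^sub>T C"
proof -
  have "A = A \<inter> {..<s0} \<union> B \<inter> {s0..}" using assms(2) by auto (metis not_le)
  moreover have "B \<inter> {s0..} \<le>\<^sub>T C"
    using assms(1) unfolding turing_le_iff Int_iff atLeast_iff
    by (intro decidable_conj decidable_le computable_const computable_nth) simp_all
  ultimately show ?thesis by (metis finite_Int finite_lessThan finite_turing_le turing_le_Un)
qed

text \<open>Iterated joins stay in the ideal and compute all the sets joined so far.\<close>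

lemma turing_ideal_upper_bound:
  fixes K :: nat
  assumes I: "turing_ideal I" and A: "\<And>k. A k \<in> I"
  shows "\<exists>C\<in>I. \<forall>k\<le>K. A k \<le>\<^sub>T C"
proof (induction K)
  case 0
  show ?case using A[of 0] turing_le_refl by auto
next
  case (Suc K)
  then obtain C where "C \<in> I" "\<forall>k\<le>K. A k \<le>\<^sub>T C" by blast
  moreover have "C \<oplus>\<^sub>T A (Suc K) \<in> I"
    using I A \<open>C \<in> I\<close> unfolding turing_ideal_def by blast
  ultimately show ?case
    by (metis le_Suc_eq turing_le_join1 turing_le_join2 turing_le_trans)
qed


section \<open>The jump\<close>

lemma computable_code_numeral_prog:
  assumes "computable C n F"
  shows "computable C n (\<lambda>xs. code (numeral_prog (F xs)))"
proof -
  \<comment> \<open>The effect on codes of one more \<open>Comp Succ\<close>: 4 is the tag of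
    \<open>Comp\<close>, and \<open>Suc (prod_encode (r, 0))\<close> is the code of the one-element
    list with entry \<open>r\<close>.\<close>
  let ?H = "\<lambda>r. prod_encode (4, prod_encode (code Succ, Suc (prod_encode (r, 0))))"
  have "rec_nat (code Zero) (\<lambda>_. ?H) b = code (numeral_prog b)" for b
    by (induction b) simp_all
  moreover have "computable C n (\<lambda>xs. rec_nat (code Zero) (\<lambda>_ r. ?H r) (F xs))"
    by (intro computable_rec_nat assms computable_const computable_prod_encode computable_Suc
        computable_nth) simp
  ultimately show ?thesis by simp
qed

text \<open>The s-m-n theorem: the parameters are hard-wired into the program by numerals, so that the
  code of the resulting program, which ignores its input, is computable from them.\<close>

lemma decidable_jump_ex:
  assumes P: "decidable C 3 (\<lambda>ys. P (ys ! 0) (ys ! 1) (ys ! 2))"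
  shows "decidable (jump C) 2 (\<lambda>xs. \<exists>n. P n (xs ! 0) (xs ! 1))"
proof -
  obtain p where p: "\<And>ys. length ys = 3 \<Longrightarrow>
      eval C p ys = Some (of_bool (\<not> P (ys ! 0) (ys ! 1) (ys ! 2)))"
    using decidable_not[OF P] unfolding decidable_def computable_def by blast
  define q where "q a b = Comp (Mu p) [numeral_prog a, numeral_prog b]" for a b
  \<comment> \<open>Halting does not depend on the input, so it may be tested on the program's own
    code, which is what \<open>jump\<close> asks.\<close>
  have "eval C (q a b) xs \<noteq> None \<longleftrightarrow> (\<exists>n. P n a b)" for a b xs
    by (simp add: q_def Let_def eval_numeral_prog p)
  then have q: "code (q a b) \<in> jump C \<longleftrightarrow> (\<exists>n. P n a b)" for a b
    unfolding jump_def using code_inject by blast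
  have "decidable (jump C) 2 (\<lambda>xs. code (q (xs ! 0) (xs ! 1)) \<in> jump C)"
    unfolding q_def code.simps list.map list_encode.simps
    by (intro decidable_mem turing_le_refl computable_prod_encode computable_Suc computable_const
        computable_code_numeral_prog computable_nth) simp_all
  then show ?thesis by (simp only: q)
qed

text \<open>One direction of Shoenfield's limit lemma: the jump recognises the stages from which the
  approximation no longer changes, so it can search for the first one and read off the
  limit.\<close>

lemma limit_turing_le_jump:
  assumes P: "decidable C 2 (\<lambda>xs. P (xs ! 0) (xs ! 1))"
    and lim: "\<And>k. eventually (\<lambda>s. P k s \<longleftrightarrow> k \<in> X) sequentially"
  shows "X \<le>\<^sub>T jump C"
proof -
  have P': "decidable C 3 (\<lambda>ys. P (ys ! 1) (ys ! 2 + ys ! 0))"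
    using P unfolding decidable_def
    by (rule computable_comp2) (intro computable_nth computable_add; simp)+
  text \<open>\<open>Q s k\<close> says that \<open>P k\<close> is constant from \<open>s\<close> on.\<close>
  define T where "T b k s \<longleftrightarrow> (\<exists>n. P k (s + n) = b)" for b k s
  have T_gen: "decidable (jump C) n (\<lambda>xs. T b (F xs) (G xs))"
    if "computable (jump C) n F" "computable (jump C) n G" for b n F G
  proof -
    have "decidable C 3 (\<lambda>ys. P (ys ! 1) (ys ! 2 + ys ! 0) = b)"
      using P' decidable_not[OF P'] by (cases b) auto
    then show ?thesis
      using decidable_jump_ex[of C "\<lambda>n k s. P k (s + n) = b"] that
      unfolding decidable_def T_def by (auto intro: computable_comp2)
  qed
  define Q where "Q s k \<longleftrightarrow> \<not> T True k s \<or> \<not> T False k s" for s k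
  define t where "t k = (LEAST s. Q s k)" for k
  have "\<exists>s. Q s k" for k
    using lim[of k] unfolding eventually_sequentially Q_def T_def by (metis le_add1)
  then have Q: "Q (t k) k" for k unfolding t_def by (metis LeastI)
  have t: "computable (jump C) 1 (\<lambda>xs. t (xs ! 0))"
    unfolding t_def
  proof (rule computable_Least)
    show "decidable (jump C) (Suc 1) (\<lambda>ys. Q (ys ! 0) (tl ys ! 0))"
      unfolding Q_def
      by (intro decidable_disj decidable_not T_gen computable_nth computable_tl_nth) simp_all
  qed (rule \<open>\<exists>s. Q s _\<close>)
  \<comment> \<open>From stage \<open>t k\<close> on the approximation is constant and thus equals
    its limit; membership means that the value \<open>False\<close> never occurs there.\<close>
  have "k \<in> X \<longleftrightarrow> \<not> T False k (t k)" for k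
    using lim[of k] Q[of k] unfolding eventually_sequentially Q_def T_def
    by (metis le_add1 le_add2)
  then show ?thesis
    unfolding turing_le_iff by (simp only:) (intro decidable_not T_gen t computable_nth, simp)
qed


section \<open>A coding that survives coarse similarity\<close>

text \<open>The numbers whose two leading binary ones are at positions \<open>s + k + 1\<close> and \<open>s\<close>.\<close>

definition block :: "nat \<Rightarrow> nat \<Rightarrow> nat set" where
  "block k s = {2 ^ (s + k + 1) + 2 ^ s..<2 ^ (s + k + 1) + 2 ^ Suc s}"

definition encode :: "nat \<Rightarrow> nat set \<Rightarrow> nat set" where
  "encode k A = (\<Union>s\<in>A. block k s)"

text \<open>The votes are counted by a sum over offsets in the block, so that decidability follows
  from the closure rules. A tie counts as a negative vote.\<close>

definition majority :: "nat set \<Rightarrow> nat \<Rightarrow> nat \<Rightarrow> bool" where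
  "majority B k s \<longleftrightarrow> 2 ^ s < 2 * (\<Sum>j<2 ^ s. of_bool (2 ^ (s + k + 1) + 2 ^ s + j \<in> B) :: nat)"

section \<open>Disjointness, size and decidability of blocks\<close>

lemma power_interval_unique:
  fixes x :: nat
  assumes "2 ^ a \<le> x" "x < 2 ^ Suc a" "2 ^ b \<le> x" "x < 2 ^ Suc b"
  shows "a = b"
proof -
  have "2 ^ a < (2::nat) ^ Suc b" "2 ^ b < (2::nat) ^ Suc a" using assms by linarith+
  then show ?thesis by (simp add: power_strict_increasing_iff del: power_Suc)
qed

lemma block_unique:
  assumes "x \<in> block k s" "x \<in> block l t"
  shows "k = l \<and> s = t"
proof -
  \<comment> \<open>The leading binary position of \<open>x\<close> recovers
    \<open>s + k + 1\<close>; that of the remainder recovers \<open>s\<close>.\<close>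
  have *: "2 ^ (s + k + 1) \<le> x \<and> x < 2 ^ Suc (s + k + 1) \<and>
      2 ^ s \<le> x - 2 ^ (s + k + 1) \<and> x - 2 ^ (s + k + 1) < 2 ^ Suc s" if "x \<in> block k s" for k s
  proof -
    have "(2::nat) ^ s \<le> 2 ^ (s + k)" by (rule power_increasing) auto
    moreover have "2 * 2 ^ (s + k) + 2 ^ s \<le> x" "x < 2 * 2 ^ (s + k) + 2 * 2 ^ s"
      using that by (simp_all add: block_def)
    ultimately have "2 * 2 ^ (s + k) \<le> x" "x < 4 * 2 ^ (s + k)"
      "2 ^ s \<le> x - 2 * 2 ^ (s + k)" "x - 2 * 2 ^ (s + k) < 2 * 2 ^ s" by linarith+
    then show ?thesis by simp
  qed
  have "s + k + 1 = t + l + 1" using *[OF assms(1)] *[OF assms(2)] power_interval_unique by blast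
  moreover from this have "s = t" using *[OF assms(1)] *[OF assms(2)] power_interval_unique by metis
  ultimately show ?thesis by simp
qed

lemma block_subset: "block k s \<subseteq> {..<2 ^ (s + k + 2)}"
proof -
  have "(2::nat) ^ Suc s \<le> 2 ^ (s + k + 1)" by (rule power_increasing) auto
  then have "2 ^ (s + k + 1) + 2 ^ Suc s \<le> (2::nat) ^ (s + k + 2)"
    by (simp add: power_add)
  then show ?thesis
    unfolding block_def by (intro subsetI) (simp only: atLeastLessThan_iff lessThan_iff, linarith)
qed

lemma encode_turing_le: "encode k A \<le>\<^sub>T A"
proof -
  \<comment> \<open>This bounds the search for \<open>s\<close> by \<open>x\<close>, turning the
    union into a bounded existential.\<close>
  have "s < x" if "x \<in> block k s" for x s
  proof -
    have "s < 2 ^ s" by (rule less_exp)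
    also have "2 ^ s \<le> x" using that by (simp add: block_def)
    finally show ?thesis .
  qed
  then have "x \<in> encode k A \<longleftrightarrow> (\<exists>s<x. s \<in> A \<and> x \<in> block k s)" for x
    by (auto simp: encode_def)
  moreover have "decidable A 1 (\<lambda>xs. \<exists>s<xs ! 0. s \<in> A \<and> xs ! 0 \<in> block k s)"
    unfolding block_def atLeastLessThan_iff
    by (intro decidable_bex decidable_conj decidable_mem decidable_le decidable_less turing_le_refl
        computable_add computable_power2 computable_Suc computable_const computable_nth
        computable_tl_nth) simp_all
  ultimately show ?thesis by (simp add: turing_le_iff)
qed

lemma decidable_majority:
  assumes "computable B n F" "computable B n G"
  shows "decidable B n (\<lambda>xs. majority B (F xs) (G xs))"
proof -
  have "decidable B 2 (\<lambda>xs. majority B (xs ! 0) (xs ! 1))"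
    unfolding majority_def
    by (intro decidable_less computable_mult computable_sum computable_add computable_power2
        computable_const computable_nth computable_tl_nth
        decidable_mem[unfolded decidable_def] turing_le_refl) simp_all
  then show ?thesis using assms unfolding decidable_def by (rule computable_comp2)
qed

lemma majority_iff: "majority B k s \<longleftrightarrow> 2 ^ s < 2 * card (B \<inter> block k s)"
proof -
  have "B \<inter> block k s = (\<lambda>j. 2 ^ (s + k + 1) + 2 ^ s + j) `
      {j\<in>{..<2 ^ s}. 2 ^ (s + k + 1) + 2 ^ s + j \<in> B}"
    (is "?L = ?f ` ?R")
  proof
    show "?L \<subseteq> ?f ` ?R"
    proof
      fix x assume x: "x \<in> ?L"
      show "x \<in> ?f ` ?R"
        by (rule image_eqI[of _ _ "x - (2 ^ (s + k + 1) + 2 ^ s)"])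
          (use x in \<open>auto simp: block_def\<close>)
    qed
  qed (auto simp: block_def)
  then have "card (B \<inter> block k s) = card ?R" by (simp add: card_image inj_on_def)
  then show ?thesis
    by (simp add: majority_def of_bool_def sum.If_cases Int_def)
qed

text \<open>At \<open>n = 2 ^ (s + k + 2)\<close> the error density is eventually less than
  \<open>1 / 2 ^ (k + 3)\<close>, so fewer than half of the \<open>2 ^ s\<close> elements of the
  block are wrong.\<close>

lemma eventually_majority:
  assumes B: "coarsely_similar (\<Union>k. encode k (h k)) B"
  shows "eventually (\<lambda>s. majority B k s \<longleftrightarrow> s \<in> h k) sequentially"
proof -
  define E where "E = sym_diff (\<Union>k. encode k (h k)) B"
  have "filterlim (\<lambda>s::nat. 2 ^ (s + k + 2) :: nat) sequentially sequentially"
    by (rule filterlim_subseq) (auto simp: strict_mono_def)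
  moreover have "eventually (\<lambda>n. density_upto n E < 1 / 2 ^ (k + 3)) sequentially"
    using B unfolding coarsely_similar_def E_def[symmetric]
    by (rule order_tendstoD) simp
  ultimately have "eventually (\<lambda>s. density_upto (2 ^ (s + k + 2)) E < 1 / 2 ^ (k + 3)) sequentially"
    by (rule eventually_compose_filterlim[rotated])
  then show ?thesis
  proof eventually_elim
    case (elim s)
    \<comment> \<open>Blocks are disjoint, so no other bit is coded in
      \<open>block k s\<close>.\<close>
    have D: "(\<Union>k. encode k (h k)) \<inter> block k s = (if s \<in> h k then block k s else {})"
      by (auto simp: encode_def dest: block_unique)
    have fin: "finite (block k s)" and card: "card (block k s) = 2 ^ s"
      by (simp_all add: block_def)
    have "real (card (E \<inter> block k s)) \<le> card (E \<inter> {..<2 ^ (s + k + 2)})"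
      using block_subset[of k s] by (intro of_nat_mono card_mono) auto
    also have "\<dots> < 2 ^ (s + k + 2) / 2 ^ (k + 3)"
      using elim by (simp add: density_upto_def field_simps)
    also have "\<dots> = 2 ^ s / 2" by (simp add: power_add field_simps)
    finally have "real (2 * card (E \<inter> block k s)) < real (2 ^ s)" by simp
    then have less: "2 * card (E \<inter> block k s) < 2 ^ s" by (simp only: of_nat_less_iff)
    show ?case
    proof (cases "s \<in> h k")
      case True
      with D have "E \<inter> block k s = block k s - B \<inter> block k s" unfolding E_def by auto
      then have "card (E \<inter> block k s) = 2 ^ s - card (B \<inter> block k s)"
        using fin card by (simp add: card_Diff_subset)
      with less True show ?thesis by (simp add: majority_iff)
    next
      case False
      with D have "E \<inter> block k s = B \<inter> block k s" unfolding E_def by auto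
      with less False show ?thesis by (simp add: majority_iff)
    qed
  qed
qed

lemma turing_le_of_coarsely_similar:
  assumes "coarsely_similar (\<Union>k. encode k (h k)) B"
  shows "h k \<le>\<^sub>T B"
proof -
  obtain s0 where "\<And>s. s \<ge> s0 \<Longrightarrow> s \<in> h k \<longleftrightarrow> s \<in> {s. majority B k s}"
    using eventually_majority[OF assms] unfolding eventually_sequentially by blast
  moreover have "{s. majority B k s} \<le>\<^sub>T B"
    unfolding turing_le_iff mem_Collect_eq
    by (intro decidable_majority computable_const computable_nth) simp
  ultimately show ?thesis using turing_le_eventually by blast
qed

text \<open>Above each power \<open>2 ^ b\<close>, the codes with index at least \<open>K\<close>
  use only the first \<open>2 ^ (b - K)\<close> numbers of the dyadic interval. The geometric series
  up to the leading position \<open>a\<close> of \<open>n\<close> then gives a bound uniform in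
  \<open>n\<close> and \<open>h\<close>.\<close>

lemma density_upto_encode_tail:
  "density_upto n (\<Union>k\<in>{K..}. encode k (h k)) \<le> 2 / 2 ^ K"
proof (cases "n = 0")
  case True
  then show ?thesis by (simp add: density_upto_def)
next
  case False
  then obtain a where a: "2 ^ a \<le> n" "n < 2 ^ Suc a"
    using ex_power_ivl1[of 2 n] by auto
  let ?T = "\<Union>k\<in>{K..}. encode k (h k)"
  have "?T \<inter> {..<n} \<subseteq> (\<Union>b\<in>{K..a}. {2 ^ b..<2 ^ b + 2 ^ (b - K)})"
  proof
    fix x assume "x \<in> ?T \<inter> {..<n}"
    then obtain k s where ks: "k \<ge> K" "x \<in> block k s" "x < n" by (auto simp: encode_def)
    have "(2::nat) ^ Suc s \<le> 2 ^ (s + k + 1 - K)" using ks(1) by (intro power_increasing) auto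
    then have "x \<in> {2 ^ (s + k + 1)..<2 ^ (s + k + 1) + 2 ^ (s + k + 1 - K)}"
      using ks(2) by (auto simp: block_def)
    moreover from this have "(2::nat) ^ (s + k + 1) < 2 ^ Suc a"
      unfolding atLeastLessThan_iff using a ks(3) by linarith
    then have "s + k + 1 \<le> a" by (simp add: power_strict_increasing_iff del: power_Suc)
    ultimately show "x \<in> (\<Union>b\<in>{K..a}. {2 ^ b..<2 ^ b + 2 ^ (b - K)})"
      using ks(1) by (intro UN_I[of "s + k + 1"]) auto
  qed
  then have "card (?T \<inter> {..<n}) \<le> card (\<Union>b\<in>{K..a}. {2 ^ b..<(2::nat) ^ b + 2 ^ (b - K)})"
    by (intro card_mono) auto
  also have "\<dots> \<le> (\<Sum>b\<in>{K..a}. card {2 ^ b..<(2::nat) ^ b + 2 ^ (b - K)})"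
    by (rule card_UN_le) simp
  finally have "card (?T \<inter> {..<n}) \<le> (\<Sum>b\<in>{K..a}. 2 ^ (b - K))"
    by simp
  then have "real (card (?T \<inter> {..<n})) \<le> real (\<Sum>b\<in>{K..a}. 2 ^ (b - K))"
    by (rule of_nat_mono)
  also have "\<dots> = (\<Sum>b\<in>{K..a}. 2 ^ (b - K))" by simp
  also have "\<dots> = (\<Sum>b\<in>{K..a}. 2 ^ b / 2 ^ K)"
    by (intro sum.cong refl) (simp add: power_diff)
  also have "\<dots> \<le> (\<Sum>b\<le>a. 2 ^ b / 2 ^ K)"
    by (intro sum_mono2) auto
  also have "\<dots> = (\<Sum>b\<le>a. 2 ^ b) / 2 ^ K" by (simp add: sum_divide_distrib)
  also have "(\<Sum>b\<le>a. 2 ^ b) = (2 ^ Suc a - 1 :: real)" by (induction a) auto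
  also have "(2 ^ Suc a - 1 :: real) / 2 ^ K \<le> 2 * real n / 2 ^ K"
  proof -
    have "(2 ^ a :: real) \<le> real n" using a(1) by (metis of_nat_le_iff of_nat_numeral of_nat_power)
    then have "(2 ^ Suc a - 1 :: real) \<le> 2 * real n" unfolding power_Suc by linarith
    then show ?thesis by (rule divide_right_mono) simp
  qed
  finally show ?thesis using False by (simp add: density_upto_def field_simps)
qed

lemma encode_tendsto:
  "(\<lambda>K. coarse_class (\<Union>k\<le>K. encode k (h k))) \<longlonglongrightarrow> coarse_class (\<Union>k. encode k (h k))"
proof (rule metric_tendsto_imp_tendsto)
  show "(\<lambda>K::nat. 2 / 2 ^ Suc K :: real) \<longlonglongrightarrow> 0"
    by (rule LIMSEQ_Suc, rule LIMSEQ_divide_realpow_zero) simp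
  show "eventually (\<lambda>K. dist (coarse_class (\<Union>k\<le>K. encode k (h k)))
      (coarse_class (\<Union>k. encode k (h k))) \<le> dist (2 / 2 ^ Suc K :: real) 0) sequentially"
  proof (rule always_eventually, rule allI)
    fix K
    let ?E = "sym_diff (\<Union>k\<le>K. encode k (h k)) (\<Union>k. encode k (h k))"
    let ?T = "\<Union>k\<in>{Suc K..}. encode k (h k)"
    \<comment> \<open>Only codes with index above \<open>K\<close> are missing. The empty set lets
      \<open>density_upto_subadd\<close> serve as monotonicity.\<close>
    have "?E \<subseteq> ?T \<union> {}"
      by (auto simp: Suc_le_eq) (metis atMost_iff greaterThan_iff atLeast_Suc_greaterThan not_le)
    then have "density_upto n ?E \<le> 2 / 2 ^ Suc K" for n
    proof -
      have "density_upto n ?E \<le> density_upto n ?T + density_upto n {}"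
        using \<open>?E \<subseteq> ?T \<union> {}\<close> by (rule density_upto_subadd)
      also have "density_upto n {} = 0" by (simp add: density_upto_def)
      finally show ?thesis using density_upto_encode_tail[of n h "Suc K"] by linarith
    qed
    then have "ereal (upper_density ?E) \<le> ereal (2 / 2 ^ Suc K)"
      unfolding ereal_upper_density by (intro Limsup_bounded) auto
    then show "dist (coarse_class (\<Union>k\<le>K. encode k (h k))) (coarse_class (\<Union>k. encode k (h k)))
        \<le> dist (2 / 2 ^ Suc K :: real) 0"
      by (simp add: dist_coarse_class.abs_eq)
  qed
qed

text \<open>Closedness applies to classes, so it yields a member of \<open>U\<close> coarsely
  similar to the limit code, not the limit code itself.\<close>

lemma closed_encode:
  assumes "closed (coarse_class ` U)" "\<And>K. (\<Union>k\<le>K. encode k (h k)) \<in> U"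
  shows "\<exists>B\<in>U. coarsely_similar (\<Union>k. encode k (h k)) B"
proof -
  have "coarse_class (\<Union>k. encode k (h k)) \<in> coarse_class ` U"
    using assms by (intro closed_sequentially[OF _ _ encode_tendsto]) auto
  then show ?thesis by (auto simp: coarse_class.abs_eq_iff)
qed

theorem theorem3p11:
  fixes U :: "nat set set"
  assumes "turing_invariant U"
    and "closed (coarse_class ` U)"
  shows "(\<forall>X. \<forall>A\<in>U. \<exists>C\<in>U. A \<le>\<^sub>T C \<and> X \<le>\<^sub>T jump C) \<and>
    (\<forall>I. countable I \<and> turing_ideal I \<and> I \<subseteq> U \<longrightarrow> (\<exists>C\<in>U. \<forall>A\<in>I. A \<le>\<^sub>T C))"
proof (intro conjI allI ballI impI)
  fix X A assume A: "A \<in> U"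
  \<comment> \<open>The shift by one reserves index 0 for \<open>A\<close>; index
    \<open>Suc k\<close> repeats the bit \<open>k\<close> of \<open>X\<close> at every position, so
    that votes on it converge to that bit.\<close>
  define h where "h k = (case k of 0 \<Rightarrow> A | Suc k \<Rightarrow> if k \<in> X then UNIV else {})" for k
  have "(\<Union>k\<le>K. encode k (h k)) \<in> U" for K
  proof -
    let ?D = "\<Union>k\<le>K. encode k (h k)"
    \<comment> \<open>No uniformity in \<open>k\<close> is claimed: each finite code involves
      finitely many bits of \<open>X\<close>, which are constants of the program.\<close>
    have "h k \<le>\<^sub>T A" for k
      by (auto simp: h_def turing_le_refl UNIV_turing_le finite_turing_le split: nat.split)
    then have "?D \<le>\<^sub>T A"
      by (intro turing_le_UN_atMost) (metis encode_turing_le turing_le_trans)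
    moreover have "A \<le>\<^sub>T ?D"
    proof -
      \<comment> \<open>The least element of \<open>block 0 s\<close> is in the finite code exactly
        when \<open>s\<close> is in \<open>A\<close>, by disjointness of blocks.\<close>
      have "2 ^ (s + 1) + 2 ^ s \<in> block 0 s" for s by (simp add: block_def)
      then have "s \<in> A \<longleftrightarrow> 2 ^ (s + 1) + 2 ^ s \<in> ?D" for s
        using block_unique[of "2 ^ (s + 1) + 2 ^ s" 0 s] by (fastforce simp: encode_def h_def)
      then show ?thesis unfolding turing_le_iff
        by (simp only:) (intro decidable_mem turing_le_refl computable_add computable_power2
            computable_const computable_nth, simp_all)
    qed
    ultimately show ?thesis
      using assms(1) A unfolding turing_invariant_def turing_equiv_def by blast
  qed
  then obtain B where "B \<in> U" and B: "coarsely_similar (\<Union>k. encode k (h k)) B"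
    using closed_encode assms(2) by blast
  have "A \<le>\<^sub>T B" using turing_le_of_coarsely_similar[OF B, of 0] by (simp add: h_def)
  moreover have "X \<le>\<^sub>T jump B"
  proof (rule limit_turing_le_jump)
    show "decidable B 2 (\<lambda>xs. majority B (Suc (xs ! 0)) (xs ! 1))"
      by (intro decidable_majority computable_Suc computable_nth) simp_all
    show "eventually (\<lambda>s. majority B (Suc k) s \<longleftrightarrow> k \<in> X) sequentially" for k
      using eventually_majority[OF B, of "Suc k"] by (simp add: h_def split: if_splits)
  qed
  ultimately show "\<exists>C\<in>U. A \<le>\<^sub>T C \<and> X \<le>\<^sub>T jump C" using \<open>B \<in> U\<close> by blast
next
  fix I assume I: "countable I \<and> turing_ideal I \<and> I \<subseteq> U"
  then have "I \<noteq> {}" by (simp add: turing_ideal_def)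
  \<comment> \<open>The enumeration may repeat members, so a finite ideal is covered too.\<close>
  define h where "h = from_nat_into I"
  have range: "range h = I" using I \<open>I \<noteq> {}\<close> by (simp add: h_def range_from_nat_into)
  have "(\<Union>k\<le>K. encode k (h k)) \<in> U" for K
  proof -
    \<comment> \<open>A bound for finitely many members exists inside the ideal; downward closure
      then puts the finite code into \<open>I\<close>, hence into \<open>U\<close>.\<close>
    obtain C where C: "C \<in> I" "\<forall>k\<le>K. h k \<le>\<^sub>T C"
      using turing_ideal_upper_bound[of I h K] I range by blast
    then have "(\<Union>k\<le>K. encode k (h k)) \<le>\<^sub>T C"
      by (intro turing_le_UN_atMost) (metis encode_turing_le turing_le_trans)
    then show ?thesis using C(1) I unfolding turing_ideal_def by blast
  qed
  then obtain B where "B \<in> U" and B: "coarsely_similar (\<Union>k. encode k (h k)) B"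
    using closed_encode assms(2) by blast
  then show "\<exists>C\<in>U. \<forall>A\<in>I. A \<le>\<^sub>T C"
    using turing_le_of_coarsely_similar[OF B] range by blast
qed

end
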